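(* For every $d \geq 4$ there exists a lattice $d$-polytope $P \subset \mathbb{R}^d$ that is a maximal hollow lattice polytope but not a maximal hollow convex body; that is, $P$ is hollow, $P$ is not properly contained in any hollow lattice polytope, but $P$ is properly contained in some hollow convex body.
   Context: A lattice polytope in $\mathbb{R}^d$ is the convex hull of finitely many points of $\mathbb{Z}^d$; a $d$-polytope is full-dimensional. A convex body (compact convex set) $K \subset \mathbb{R}^d$ is hollow if its interior contains no point of $\mathbb{Z}^d$. A hollow lattice polytope is maximal hollow (as a lattice polytope) if it is not properly contained in a larger hollow lattice polytope; a hollow convex body is maximal as a hollow convex body if it is not properly contained in a larger hollow convex body. *)

theory Defs
  imports "HOL-Analysis.Analysis"
begin

definition integer_points :: "(real ^ 'n) set" where
  "integer_points = {x. \<forall>i. x $ i \<in> \<int>}"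

definition lattice_polytope :: "(real ^ 'n) set \<Rightarrow> bool" where
  "lattice_polytope P \<longleftrightarrow> (\<exists>V. finite V \<and> V \<subseteq> integer_points \<and> P = convex hull V)"

definition convex_body :: "(real ^ 'n) set \<Rightarrow> bool" where
  "convex_body K \<longleftrightarrow> compact K \<and> convex K"

text \<open>The interior is the topological interior in the ambient space, not the relative
  interior, so a convex body that is not full-dimensional is hollow.\<close>

definition hollow :: "(real ^ 'n) set \<Rightarrow> bool" where
  "hollow K \<longleftrightarrow> interior K \<inter> integer_points = {}"

definition maximal_hollow_lattice_polytope :: "(real ^ 'n) set \<Rightarrow> bool" where
  "maximal_hollow_lattice_polytope P \<longleftrightarrow> lattice_polytope P \<and> hollow P \<and>
     \<not> (\<exists>Q. lattice_polytope Q \<and> hollow Q \<and> P \<subset> Q)"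

definition maximal_hollow_convex_body :: "(real ^ 'n) set \<Rightarrow> bool" where
  "maximal_hollow_convex_body K \<longleftrightarrow> convex_body K \<and> hollow K \<and>
     \<not> (\<exists>L. convex_body L \<and> hollow L \<and> K \<subset> L)"

lemma lattice_polytope_imp_convex_body: "lattice_polytope P \<Longrightarrow> convex_body P"
  unfolding lattice_polytope_def convex_body_def
  by (auto intro: finite_imp_compact_convex_hull)

text \<open>For a hollow lattice polytope, failing to be a maximal hollow convex body can only mean
  that it is properly contained in some hollow convex body.\<close>

lemma not_maximal_hollow_convex_body_iff:
  assumes "lattice_polytope P" and "hollow P"
  shows "\<not> maximal_hollow_convex_body P \<longleftrightarrow> (\<exists>K. convex_body K \<and> hollow K \<and> P \<subset> K)"
  using assms lattice_polytope_imp_convex_body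
  unfolding maximal_hollow_convex_body_def by blast

end

theory Submission
  imports Defs
begin

text \<open>Write \<open>d\<close> for the dimension and let \<open>S\<close> be the simplex given by \<open>x \<ge> 0\<close> and
  \<open>(d - 2) x\<^sub>a + (\<Sum>j\<noteq>a. x\<^sub>j) \<le> 2d - 3\<close>. An interior integer point would have all coordinates at
  least \<open>1\<close>, which already makes the last inequality an equality, so \<open>S\<close> is hollow. Its vertex on
  the \<open>a\<close>-th axis, at height \<open>2 + 1 / (d - 2)\<close>, is not integral. Let \<open>P\<close> be the part of \<open>S\<close> with
  \<open>x\<^sub>a \<le> 2\<close>, a lattice polytope that contains all integer points of \<open>S\<close>. An integer point \<open>v\<close> outside
  \<open>P\<close> therefore violates an inequality defining \<open>S\<close>. The corresponding facet of \<open>P\<close> has an integer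
  point \<open>p\<close> in its relative interior: all coordinates of \<open>p\<close> are \<open>1\<close>, except that \<open>p\<^sub>i = 0\<close> for the
  facet \<open>x\<^sub>i = 0\<close>. Hence \<open>p\<close> is an interior point of the convex hull of \<open>P\<close> and \<open>v\<close>.\<close>

section \<open>The hollow simplex and its truncation\<close>

definition weighted_sum :: "'n::finite \<Rightarrow> real ^ 'n \<Rightarrow> real" where
  "weighted_sum a x = (real CARD('n) - 3) * x $ a + (\<Sum>i\<in>UNIV. x $ i)"

definition big_simplex :: "'n::finite \<Rightarrow> (real ^ 'n) set" where
  "big_simplex a = {x. (\<forall>i. 0 \<le> x $ i) \<and> weighted_sum a x \<le> 2 * real CARD('n) - 3}"

definition cut_simplex :: "'n::finite \<Rightarrow> (real ^ 'n) set" where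
  "cut_simplex a = big_simplex a \<inter> {x. x $ a \<le> 2}"

text \<open>The corners of two slices: height \<open>0\<close>, a standard simplex of size
  \<open>2d - 3\<close>, and height \<open>2\<close>, where \<open>2d - 3 - 2(d - 2) = 1\<close> is
  the remaining size.\<close>

definition cut_vertices :: "'n::finite \<Rightarrow> (real ^ 'n) set" where
  "cut_vertices a = {0, axis a 2} \<union> (\<lambda>j. axis a 2 + axis j 1) ` (- {a})
     \<union> (\<lambda>j. axis j (2 * real CARD('n) - 3)) ` (- {a})"

lemma sum_axis: "(\<Sum>i\<in>UNIV. axis j c $ i) = (c::real)"
  for j :: "'n::finite"
  by (simp add: axis_def)

lemma norm_axis: "norm (axis i c) = \<bar>c\<bar>" for c :: real
proof -
  have "axis i c = c *\<^sub>R axis i 1"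
    by (simp add: vec_eq_iff axis_def)
  then show ?thesis
    by simp
qed

lemma linear_weighted_sum: "linear (weighted_sum a)"
  by (rule linearI) (simp_all add: weighted_sum_def sum.distrib sum_distrib_left algebra_simps)

lemma weighted_sum_axis:
  "weighted_sum a (axis j c) = (if j = a then (real CARD('n) - 2) * c else c)"
  for a j :: "'n::finite"
  unfolding weighted_sum_def sum_axis by (auto simp: axis_def algebra_simps)

lemma convex_big_simplex: "convex (big_simplex a)"
proof -
  have "big_simplex a = (\<Inter>i. {x. 0 \<le> x $ i}) \<inter>
      weighted_sum a -` {..2 * real CARD('a) - 3}"
    by (auto simp: big_simplex_def)
  moreover have "convex {x :: real ^ 'a. 0 \<le> x $ i}" for i
    by (auto simp: convex_def)
  ultimately show ?thesis
    by (auto intro!: convex_Int convex_INT convex_linear_vimage linear_weighted_sum)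
qed

lemma convex_cut_simplex: "convex (cut_simplex a)"
proof -
  have "convex {x :: real ^ 'a. x $ a \<le> 2}"
    using convex_halfspace_le[of "axis a (1::real)" 2] by (simp add: inner_axis')
  then show ?thesis
    unfolding cut_simplex_def by (intro convex_Int convex_big_simplex)
qed

section \<open>Vertices of the truncation\<close>

lemma cut_vertices_subset:
  fixes a :: "'n::finite"
  assumes "CARD('n) \<ge> 4"
  shows "cut_vertices a \<subseteq> cut_simplex a"
proof -
  have "weighted_sum a 0 = 0"
    by (simp add: weighted_sum_def)
  then show ?thesis
    using assms
    by (auto simp: cut_vertices_def cut_simplex_def big_simplex_def
        linear_add[OF linear_weighted_sum] weighted_sum_axis)
      (auto simp: axis_def)
qed

text \<open>Each point is a convex combination of the corners of its horizontal slice, and each such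
  corner lies on a segment joining a vertex at height \<open>0\<close> to one at height
  \<open>2\<close>.\<close>

lemma cut_simplex_eq_hull:
  fixes a :: "'n::finite"
  assumes "CARD('n) \<ge> 4"
  shows "cut_simplex a = convex hull (cut_vertices a)"
proof
  let ?H = "convex hull (cut_vertices a)" and ?m = "2 * real CARD('n) - 3"
  show "?H \<subseteq> cut_simplex a"
    by (intro hull_minimal cut_vertices_subset assms convex_cut_simplex)
  show "cut_simplex a \<subseteq> ?H"
  proof
    fix x assume "x \<in> cut_simplex a"
    then have x0: "\<And>i. 0 \<le> x $ i" and xa: "x $ a \<le> 2" and xm: "weighted_sum a x \<le> ?m"
      by (auto simp: cut_simplex_def big_simplex_def)
    \<comment> \<open>The slice of the polytope at height \<open>2 * t\<close> is a standard simplex dilated by \<open>D\<close>.\<close>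
    define t where "t = x $ a / 2"
    define D where "D = (1 - t) * ?m + t"
    have t: "0 \<le> t" "t \<le> 1" using x0 xa by (auto simp: t_def)
    have "D \<ge> (1 - t) * 1 + t"
      unfolding D_def using t assms by (intro add_mono mult_left_mono) auto
    then have D: "D > 0" by simp
    have sum_split: "(\<Sum>j\<in>UNIV. f j) = f a + (\<Sum>j\<in>-{a}. f j)" for f :: "'n \<Rightarrow> real"
      by (simp add: sum.remove[of UNIV a] Compl_eq_Diff_UNIV)
    have s_le: "(\<Sum>j\<in>-{a}. x $ j) \<le> D"
      using xm by (simp add: weighted_sum_def sum_split D_def t_def field_simps)
    have H: "convex ?H" by (rule convex_convex_hull)
    have V: "0 \<in> ?H" "axis a 2 \<in> ?H"
      "\<And>j. j \<noteq> a \<Longrightarrow> axis a 2 + axis j 1 \<in> ?H"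
      "\<And>j. j \<noteq> a \<Longrightarrow> axis j ?m \<in> ?H"
      by (auto intro!: hull_inc simp: cut_vertices_def)
    have base: "axis a (2 * t) \<in> ?H"
    proof -
      have "(1 - t) *\<^sub>R 0 + t *\<^sub>R axis a 2 \<in> ?H"
        by (rule convexD[OF H]) (use t V(1,2) in simp_all)
      also have "(1 - t) *\<^sub>R 0 + t *\<^sub>R axis a 2 = (axis a (2 * t) :: real ^ 'n)"
        by (auto simp: vec_eq_iff axis_def)
      finally show ?thesis .
    qed
    have corner: "axis a (2 * t) + axis j D \<in> ?H" if "j \<noteq> a" for j
    proof -
      have "(1 - t) *\<^sub>R axis j ?m + t *\<^sub>R (axis a 2 + axis j 1) \<in> ?H"
        by (rule convexD[OF H]) (use t V(3,4)[OF that] in simp_all)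
      also have "(1 - t) *\<^sub>R axis j ?m + t *\<^sub>R (axis a 2 + axis j 1) = axis a (2 * t) + axis j D"
        using that by (auto simp: vec_eq_iff axis_def D_def)
      finally show ?thesis .
    qed
    \<comment> \<open>Barycentric coordinates of \<open>x\<close> in its slice; index
      \<open>a\<close> stands for the corner on the \<open>a\<close>-th axis and takes the leftover
      weight.\<close>
    define c where "c j = (if j = a then 1 - (\<Sum>j\<in>-{a}. x $ j / D) else x $ j / D)" for j
    define y where "y j = (if j = a then axis a (2 * t) else axis a (2 * t) + axis j D)" for j
    have csum: "(\<Sum>j\<in>UNIV. c j) = 1"
      unfolding sum_split by (simp add: c_def)
    have "(\<Sum>j\<in>-{a}. x $ j / D) \<le> 1"
      using s_le D by (simp add: sum_divide_distrib[symmetric])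
    then have c0: "0 \<le> c j" for j
      using x0 D by (auto simp: c_def)
    have "(\<Sum>j\<in>UNIV. c j *\<^sub>R y j) \<in> ?H"
      by (rule convex_sum) (use csum c0 base corner in \<open>auto simp: y_def\<close>)
    also have "(\<Sum>j\<in>UNIV. c j *\<^sub>R y j) = x"
    proof (rule vec_eq_iff[THEN iffD2], rule allI)
      fix i
      have "(\<Sum>j\<in>UNIV. c j *\<^sub>R y j) $ i = (\<Sum>j\<in>UNIV. c j * axis a (2 * t) $ i +
          (if j = i then if i = a then 0 else c i * D else 0))"
        unfolding sum_component
        by (rule sum.cong) (auto simp: y_def axis_def algebra_simps)
      also have "\<dots> = axis a (2 * t) $ i + (if i = a then 0 else c i * D)"
        by (simp add: sum.distrib sum_distrib_right[symmetric] csum)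
      also have "\<dots> = x $ i"
        using D by (auto simp: axis_def t_def c_def)
      finally show "(\<Sum>j\<in>UNIV. c j *\<^sub>R y j) $ i = x $ i" .
    qed
    finally show "x \<in> ?H" .
  qed
qed

lemma lattice_polytope_cut_simplex:
  fixes a :: "'n::finite"
  assumes "CARD('n) \<ge> 4"
  shows "lattice_polytope (cut_simplex a)"
  unfolding lattice_polytope_def
proof (intro exI conjI)
  show "finite (cut_vertices a)"
    by (simp add: cut_vertices_def)
  show "cut_vertices a \<subseteq> integer_points"
    by (auto simp: cut_vertices_def integer_points_def axis_def)
  show "cut_simplex a = convex hull (cut_vertices a)"
    by (rule cut_simplex_eq_hull[OF assms])
qed

section \<open>The simplex as a hollow convex body\<close>

lemma continuous_on_weighted_sum: "continuous_on A (weighted_sum a)"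
  by (rule linear_continuous_on[OF linear_conv_bounded_linear[THEN iffD1, OF linear_weighted_sum]])

lemma convex_body_big_simplex:
  fixes a :: "'n::finite"
  assumes "CARD('n) \<ge> 4"
  shows "convex_body (big_simplex a)"
proof -
  have "closed (big_simplex a)"
    unfolding big_simplex_def
    by (intro closed_Collect_conj closed_Collect_all closed_Collect_le
        continuous_on_weighted_sum continuous_intros)
  moreover have "x $ i \<le> 2 * real CARD('n) - 3" if "x \<in> big_simplex a" for x i
  proof -
    have x0: "\<And>i. 0 \<le> x $ i" and xm: "weighted_sum a x \<le> 2 * real CARD('n) - 3"
      using that by (auto simp: big_simplex_def)
    have "x $ i \<le> (\<Sum>i\<in>UNIV. x $ i)"
      by (rule member_le_sum) (auto simp: x0)
    moreover have "0 \<le> (real CARD('n) - 3) * x $ a"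
      using assms x0 by simp
    ultimately show ?thesis
      using xm by (simp add: weighted_sum_def)
  qed
  then have "big_simplex a \<subseteq> cbox 0 (\<chi> i. 2 * real CARD('n) - 3)"
    by (auto simp: mem_box_cart big_simplex_def)
  then have "bounded (big_simplex a)"
    by (rule bounded_subset[OF bounded_cbox])
  ultimately show ?thesis
    by (simp add: convex_body_def compact_eq_bounded_closed convex_big_simplex)
qed

lemma Ints_pos_ge_1: "1 \<le> x" if "x \<in> \<int>" "0 < x" for x :: real
  using that by (auto elim!: Ints_cases)

lemma hollow_big_simplex:
  fixes a :: "'n::finite"
  assumes "CARD('n) \<ge> 4"
  shows "hollow (big_simplex a)"
  unfolding hollow_def
proof (rule equals0I, elim IntE)
  fix x :: "real ^ 'n"
  assume int: "x \<in> interior (big_simplex a)" and x: "x \<in> integer_points"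
  from int obtain e where e: "e > 0" "cball x e \<subseteq> big_simplex a"
    using mem_interior_cball by blast
  have "1 \<le> x $ i" for i
  proof -
    \<comment> \<open>Room to move down by \<open>e\<close> forces \<open>x $ i \<ge> e\<close>,
      hence positivity.\<close>
    have "x - axis i e \<in> big_simplex a"
      using e by (intro subsetD[OF e(2)]) (simp add: dist_norm norm_axis)
    then have "0 \<le> (x - axis i e) $ i"
      by (simp add: big_simplex_def del: vector_minus_component)
    then have "0 < x $ i"
      using e by simp
    then show ?thesis
      using x by (auto simp: integer_points_def intro: Ints_pos_ge_1)
  qed
  then have "real CARD('n) - 3 + real CARD('n) \<le> weighted_sum a x"
    unfolding weighted_sum_def
    using assms sum_mono[of UNIV "\<lambda>_. 1" "\<lambda>i. x $ i"]
      mult_left_mono[of 1 "x $ a" "real CARD('n) - 3"]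
    by (intro add_mono) auto
  \<comment> \<open>Room to move up along \<open>a\<close> would push the weighted sum, already at
    least \<open>2d - 3\<close>, beyond its bound.\<close>
  moreover have "x + axis a e \<in> big_simplex a"
    using e by (intro subsetD[OF e(2)]) (simp add: dist_norm norm_axis)
  then have "weighted_sum a x + (real CARD('n) - 2) * e \<le> 2 * real CARD('n) - 3"
    by (simp add: big_simplex_def linear_add[OF linear_weighted_sum] weighted_sum_axis)
  moreover have "0 < (real CARD('n) - 2) * e"
    using assms e by simp
  ultimately show False
    by linarith
qed

section \<open>Facet points that become interior\<close>

lemma interior_cut_simplexI:
  fixes a :: "'n::finite"
  assumes "\<And>i. 0 < x $ i" "x $ a < 2" "weighted_sum a x < 2 * real CARD('n) - 3"
  shows "x \<in> interior (cut_simplex a)"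
proof (rule interiorI)
  let ?U = "{x. (\<forall>i. 0 < x $ i) \<and> x $ a < 2 \<and> weighted_sum a x < 2 * real CARD('n) - 3}"
  have "?U = (\<Inter>i. {x. 0 < x $ i}) \<inter> {x. x $ a < 2} \<inter>
      {x. weighted_sum a x < 2 * real CARD('n) - 3}"
    by auto
  then show "open ?U"
    by (simp only:) (intro open_Int open_INT ballI finite open_Collect_less
        continuous_on_weighted_sum continuous_intros)
  show "x \<in> ?U"
    using assms by simp
  show "?U \<subseteq> cut_simplex a"
    by (auto simp: cut_simplex_def big_simplex_def intro: less_imp_le)
qed

text \<open>Controls one defining inequality along a ray: continuity suffices if it is strict at the
  start, and a negative slope if it is tight.\<close>

lemma eventually_affine_less:
  fixes b c r :: real
  assumes "b < r \<or> b = r \<and> c < 0"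
  shows "\<forall>\<^sub>F s in at_right 0. b + s * c < r"
  using assms
proof
  assume "b < r"
  moreover have "((\<lambda>s. b + s * c) \<longlongrightarrow> b + 0 * c) (at_right 0)"
    by (intro tendsto_intros)
  ultimately show ?thesis
    by (auto dest: order_tendstoD)
next
  assume "b = r \<and> c < 0"
  then show ?thesis
    by (auto simp: mult_pos_neg intro: eventually_at_right_less[THEN eventually_mono])
qed

text \<open>The point \<open>p + s (p - v)\<close> is interior for small \<open>s > 0\<close>, and \<open>p\<close> lies on the segment from
  it to \<open>v\<close>.\<close>

lemma interior_extension_cut_simplex:
  fixes a :: "'n::finite"
  assumes Q: "convex Q" "cut_simplex a \<subseteq> Q" "v \<in> Q"
    and pos: "\<And>i. 0 < p $ i \<or> p $ i = 0 \<and> v $ i < 0"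
    and pa: "p $ a < 2"
    and le: "weighted_sum a p < 2 * real CARD('n) - 3 \<or>
      weighted_sum a p = 2 * real CARD('n) - 3 \<and> 2 * real CARD('n) - 3 < weighted_sum a v"
  shows "p \<in> interior Q"
proof -
  define u where "u s = p + s *\<^sub>R (p - v)" for s
  have "\<forall>\<^sub>F s in at_right 0. \<forall>i. - p $ i + s * (v $ i - p $ i) < 0"
    by (intro eventually_all_finite eventually_affine_less) (use pos in force)
  moreover have "\<forall>\<^sub>F s in at_right 0. p $ a + s * (p $ a - v $ a) < 2"
    by (intro eventually_affine_less) (use pa in simp)
  moreover have "\<forall>\<^sub>F s in at_right 0.
      weighted_sum a p + s * (weighted_sum a p - weighted_sum a v) < 2 * real CARD('n) - 3"
    by (intro eventually_affine_less) (use le in auto)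
  ultimately have "\<forall>\<^sub>F s in at_right 0. s > 0 \<and> u s \<in> interior (cut_simplex a)"
    using eventually_at_right_less
  proof eventually_elim
    case (elim s)
    have "0 < u s $ i" for i
      using elim(1)[rule_format, of i] by (simp add: u_def algebra_simps)
    moreover have "u s $ a < 2"
      using elim(2) by (simp add: u_def)
    moreover have "weighted_sum a (u s) < 2 * real CARD('n) - 3"
      using elim(3) by (simp add: u_def linear_add[OF linear_weighted_sum]
          linear_diff[OF linear_weighted_sum] linear_cmul[OF linear_weighted_sum])
    ultimately show ?case
      using elim(4) interior_cut_simplexI by blast
  qed
  then obtain s where s: "s > 0" "u s \<in> interior (cut_simplex a)"
    using eventually_happens' trivial_limit_at_right_real by blast
  then have "u s \<in> interior Q"
    using interior_mono[OF Q(2)] by blast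
  \<comment> \<open>As \<open>v - u s = (1 + s) *\<^sub>R (v - p)\<close>, the factor
    \<open>1 / (1 + s)\<close> makes this point equal to \<open>p\<close>.\<close>
  then have "v - (1 / (1 + s)) *\<^sub>R (v - u s) \<in> interior Q"
    using s Q by (intro mem_interior_convex_shrink) auto
  moreover have "v - u s = (1 + s) *\<^sub>R (v - p)"
    by (simp add: u_def algebra_simps)
  ultimately show ?thesis
    using s by simp
qed

section \<open>Integer points outside the truncation\<close>

lemma integer_point_cut_simplexI:
  fixes a :: "'n::finite"
  assumes card: "CARD('n) \<ge> 4" and x: "x \<in> integer_points" "x \<in> big_simplex a"
  shows "x \<in> cut_simplex a"
proof -
  have x0: "\<And>i. 0 \<le> x $ i" and xm: "weighted_sum a x \<le> 2 * real CARD('n) - 3"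
    using x by (auto simp: big_simplex_def)
  have "x $ a \<le> (\<Sum>i\<in>UNIV. x $ i)"
    by (rule member_le_sum) (auto simp: x0)
  then have le: "(real CARD('n) - 2) * x $ a \<le> 2 * real CARD('n) - 3"
    using xm by (simp add: weighted_sum_def algebra_simps)
  have "x $ a \<le> 2"
  proof (rule ccontr)
    assume "\<not> x $ a \<le> 2"
    then have "1 \<le> x $ a - 2"
      using x by (intro Ints_pos_ge_1) (auto simp: integer_points_def)
    \<comment> \<open>An integral height above \<open>2\<close> is at least \<open>3\<close>, but
      \<open>3(d - 2) > 2d - 3\<close> once \<open>d > 3\<close>.\<close>
    then have "(real CARD('n) - 2) * 3 \<le> (real CARD('n) - 2) * x $ a"
      using card by (intro mult_left_mono) auto
    then show False
      using le card by simp
  qed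
  then show ?thesis
    using x by (simp add: cut_simplex_def)
qed

lemma not_hollow_extension_cut_simplex:
  fixes a :: "'n::finite"
  assumes card: "CARD('n) \<ge> 4" and Q: "convex Q" "cut_simplex a \<subseteq> Q"
    and v: "v \<in> Q" "v \<in> integer_points" "v \<notin> cut_simplex a"
  shows "\<not> hollow Q"
proof -
  have "v \<notin> big_simplex a"
    using integer_point_cut_simplexI[OF card] v by blast
  then consider i where "v $ i < 0" | "2 * real CARD('n) - 3 < weighted_sum a v"
    by (auto simp: big_simplex_def not_le)
  then obtain p where "p \<in> interior Q" "p \<in> integer_points"
  proof cases
    case 1
    define p :: "real ^ 'n" where "p = (\<chi> j. 1) - axis i 1"
    have p_nth: "p $ j = (if j = i then 0 else 1)" for j
      by (simp add: p_def axis_def)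
    have "(\<Sum>j\<in>UNIV. p $ j) = real CARD('n) - 1"
      by (simp add: p_def sum_subtractf sum_axis)
    \<comment> \<open>The weighted sum is \<open>d - 1\<close> if \<open>i = a\<close> and
      \<open>2d - 4\<close> otherwise.\<close>
    then have "weighted_sum a p < 2 * real CARD('n) - 3"
      using card by (simp add: weighted_sum_def p_nth)
    then have "p \<in> interior Q"
      using 1 by (intro interior_extension_cut_simplex[OF Q v(1)]) (auto simp: p_nth)
    moreover have "p \<in> integer_points"
      by (simp add: p_nth integer_points_def)
    ultimately show ?thesis
      using that by blast
  next
    case 2
    define p :: "real ^ 'n" where "p = (\<chi> j. 1)"
    have "weighted_sum a p = 2 * real CARD('n) - 3"
      by (simp add: weighted_sum_def p_def)
    then have "p \<in> interior Q"
      using 2 by (intro interior_extension_cut_simplex[OF Q v(1)]) (auto simp: p_def)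
    moreover have "p \<in> integer_points"
      by (simp add: p_def integer_points_def)
    ultimately show ?thesis
      using that by blast
  qed
  then show ?thesis
    by (auto simp: hollow_def)
qed

section \<open>Proper containment, maximality and dimension\<close>

lemma cut_simplex_psubset_big_simplex:
  fixes a :: "'n::finite"
  assumes "CARD('n) \<ge> 4"
  shows "cut_simplex a \<subset> big_simplex a"
proof -
  \<comment> \<open>The height \<open>2 + 1 / (d - 2)\<close> of the vertex that was cut
    off.\<close>
  define c where "c = (2 * real CARD('n) - 3) / (real CARD('n) - 2)"
  have "c > 2" "(real CARD('n) - 2) * c = 2 * real CARD('n) - 3"
    using assms by (simp_all add: c_def field_simps)
  then have "axis a c \<in> big_simplex a" "axis a c \<notin> cut_simplex a"
    by (auto simp: big_simplex_def cut_simplex_def weighted_sum_axis) (auto simp: axis_def)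
  moreover have "cut_simplex a \<subseteq> big_simplex a"
    by (auto simp: cut_simplex_def)
  ultimately show ?thesis
    by blast
qed

lemma maximal_hollow_lattice_polytope_cut_simplex:
  fixes a :: "'n::finite"
  assumes card: "CARD('n) \<ge> 4"
  shows "maximal_hollow_lattice_polytope (cut_simplex a)"
  unfolding maximal_hollow_lattice_polytope_def
proof (intro conjI notI)
  show "lattice_polytope (cut_simplex a)"
    by (rule lattice_polytope_cut_simplex[OF card])
  show "hollow (cut_simplex a)"
    using hollow_big_simplex[OF card, of a] interior_mono[of "cut_simplex a" "big_simplex a"]
    by (auto simp: hollow_def cut_simplex_def)
  assume "\<exists>Q. lattice_polytope Q \<and> hollow Q \<and> cut_simplex a \<subset> Q"
  then obtain W where W: "W \<subseteq> integer_points" "hollow (convex hull W)"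
      "cut_simplex a \<subset> convex hull W"
    by (auto simp: lattice_polytope_def)
  \<comment> \<open>Otherwise convexity would put the whole hull inside; so some generator, an
    integer point, lies outside.\<close>
  then have "\<not> W \<subseteq> cut_simplex a"
    using hull_minimal[of W "cut_simplex a" convex] convex_cut_simplex by blast
  then obtain v where "v \<in> W" "v \<notin> cut_simplex a"
    by blast
  then show False
    using W not_hollow_extension_cut_simplex[OF card, of "convex hull W" a v]
    by (auto simp: hull_inc)
qed

lemma aff_dim_cut_simplex:
  fixes a :: "'n::finite"
  assumes "CARD('n) \<ge> 4"
  shows "aff_dim (cut_simplex a) = int CARD('n)"
proof -
  \<comment> \<open>Half the all-ones point has half the maximal weighted sum, so every inequality
    is strict.\<close>
  have "(\<chi> i. 1 / 2) \<in> interior (cut_simplex a)"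
    using assms by (intro interior_cut_simplexI) (auto simp: weighted_sum_def field_simps)
  then show ?thesis
    using aff_dim_nonempty_interior[of "cut_simplex a"] by (auto simp: DIM_cart)
qed

theorem theorem1p4:
  assumes "CARD('n::finite) \<ge> 4"
  shows "\<exists>P :: (real ^ 'n) set.
    lattice_polytope P \<and> aff_dim P = int CARD('n) \<and>
    maximal_hollow_lattice_polytope P \<and> \<not> maximal_hollow_convex_body P"
proof (intro exI conjI)
  fix a :: 'n
  show "lattice_polytope (cut_simplex a)"
    by (rule lattice_polytope_cut_simplex[OF assms])
  show "aff_dim (cut_simplex a) = int CARD('n)"
    by (rule aff_dim_cut_simplex[OF assms])
  show "maximal_hollow_lattice_polytope (cut_simplex a)"
    by (rule maximal_hollow_lattice_polytope_cut_simplex[OF assms])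
  show "\<not> maximal_hollow_convex_body (cut_simplex a)"
    using convex_body_big_simplex[OF assms] hollow_big_simplex[OF assms]
      cut_simplex_psubset_big_simplex[OF assms]
    unfolding maximal_hollow_convex_body_def by metis
qed

end
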